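(* Let $1\leq n<m$. Then $$C_{M_{2n+1},M_{2n+1}}(z) = z^{F_{2n+1}-1} + \sum_{i=0}^{n-1} z^{F_{2(n-i)}-1},$$ $$C_{M_{2n+2},M_{2n+2}}(z) = z^{F_{2n+2}-1} + \sum_{i=0}^{n} z^{F_{2(n-i)+1}-1},$$ $$C_{M_{2n+1},M_{2m+1}}(z) = C_{M_{2m+1},M_{2n+1}}(z) = \sum_{i=0}^{n-1} z^{F_{2(n-i)}-1},$$ $$C_{M_{2n+2},M_{2m+2}}(z) = C_{M_{2m+2},M_{2n+2}}(z) = \sum_{i=0}^{n} z^{F_{2(n-i)+1}-1},$$ $$C_{M_{2n+1},M_{2m+2}}(z) = C_{M_{2m+2},M_{2n+1}}(z) = 0,$$ $$C_{M_{2m+1},M_{2n+2}}(z) = C_{M_{2n+2},M_{2m+1}}(z) = 0.$$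
   Context: Fibonacci numbers: $F_1=F_2=1$, $F_n=F_{n-1}+F_{n-2}$. Finite Fibonacci words: $f_1=1$, $f_2=0$, $f_{n+2}=f_{n+1}f_n$ (so $|f_n|=F_n$). For $n\geq 3$, $p_n$ is $f_n$ with its last two letters deleted. The minimal forbidden factors of the infinite Fibonacci word are $M_{2n+1}=1p_{2n+1}1$ and $M_{2n+2}=0p_{2n+2}0$ for $n\geq 1$ (so $|M_n|=F_n$; e.g. $M_3=11$, $M_4=000$, $M_5=10101$, $M_6=00100100$). Words are indexed from $0$. For $u$ of length $n$ and $v$ of length $m$, the correlation $C_{u,v}$ is the binary word of length $n$ with $C_{u,v}[k]=1$ iff $u[i]=v[j]$ for all $0\le i<n$, $0\le j<m$ with $i=j+k$ (and $0$ otherwise); its correlation polynomial is $C_{u,v}(z)=\sum_{k=0}^{n-1}C_{u,v}[k]z^{n-1-k}$. *)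

theory Defs
  imports
    "HOL-Number_Theory.Fib"
    "HOL-Computational_Algebra.Polynomial"
begin

(* Words are lists. Indices start at 1; the value at 0 is a dummy, since no word f_0
   satisfies f_2 = f_1 f_0. *)
fun fib_word :: "nat \<Rightarrow> nat list" where
  "fib_word 0 = []"
| "fib_word (Suc 0) = [1]"
| "fib_word (Suc (Suc 0)) = [0]"
| "fib_word (Suc (Suc (Suc n))) = fib_word (Suc (Suc n)) @ fib_word (Suc n)"

(* Meaningful for n >= 3 only, as is min_forbidden. *)
definition fib_prefix :: "nat \<Rightarrow> nat list" where
  "fib_prefix n = butlast (butlast (fib_word n))"

(* The n-th minimal forbidden factor M_n of the infinite Fibonacci word, given explicitly:
   1 p_n 1 for odd n and 0 p_n 0 for even n. *)
definition min_forbidden :: "nat \<Rightarrow> nat list" where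
  "min_forbidden n =
     (if odd n then [1] @ fib_prefix n @ [1] else [0] @ fib_prefix n @ [0])"

definition correlation :: "'a list \<Rightarrow> 'a list \<Rightarrow> nat list" where
  "correlation u v =
     map (\<lambda>k. if \<forall>i<length u. \<forall>j<length v. i = j + k \<longrightarrow> u ! i = v ! j then 1 else 0)
       [0..<length u]"

definition correlation_poly :: "'a list \<Rightarrow> 'a list \<Rightarrow> int poly" where
  "correlation_poly u v =
     (\<Sum>k<length u. monom (int (correlation u v ! k)) (length u - 1 - k))"

end

theory Submission
  imports Defs "HOL-Library.Sublist"
begin

text \<open>
  Everything is driven by the Fibonacci morphism \<open>0 \<mapsto> 01, 1 \<mapsto> 0\<close>, under which
  \<open>p\<^sub>n\<close> is sent to \<open>p\<^sub>n\<^sub>+\<^sub>1\<close> up to a final \<open>0\<close>, and \<open>M\<^sub>n\<close> to \<open>M\<^sub>n\<^sub>+\<^sub>1\<close> up to a \<open>0\<close> at one end. Desubstituting,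
  an occurrence of \<open>M\<^sub>a\<close> in \<open>M\<^sub>b\<close> with \<open>a < b\<close> descends to an occurrence of \<open>M\<^sub>3 = 11\<close>, which is
  impossible; so only proper overlaps contribute to the correlations. In an overlap
  \<open>c z c'\<close> of \<open>M\<^sub>a\<close> and \<open>M\<^sub>b\<close>, both \<open>z c'\<close> and (by reversal) \<open>z\<^sup>R c\<close> are prefixes of the Fibonacci
  word. Hence \<open>z\<close> is a palindrome and \<open>c = c'\<close>, which forces \<open>a\<close> and \<open>b\<close> to have the same parity.
  By desubstitution again the palindromic prefixes are the \<open>p\<^sub>k\<close>, and the letter that follows
  \<open>p\<^sub>k\<close> is determined by the parity of \<open>k\<close>, so the overlap lengths are the \<open>F\<^sub>k\<close> with \<open>k\<close> of
  parity opposite to \<open>a\<close>; \<open>F\<^sub>1\<close> and \<open>F\<^sub>2\<close> stand for the one-letter overlap.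
\<close>

section \<open>The Fibonacci morphism\<close>

text \<open>Every nonzero letter is treated as 1, so decoding is unique only for words over
  \<open>{0, 1}\<close>.\<close>

definition fib_subst :: "nat list \<Rightarrow> nat list" where
  "fib_subst w = concat (map (\<lambda>x. if x = 0 then [0, 1] else [0]) w)"

lemma fib_subst_simps [simp]:
  "fib_subst [] = []"
  "fib_subst (x # w) = (if x = 0 then [0, 1] else [0]) @ fib_subst w"
  "fib_subst (v @ w) = fib_subst v @ fib_subst w"
  by (simp_all add: fib_subst_def)

text \<open>Both blocks 01 and 0 begin with 0. The final 0 supplies this after the last block too,
  so one letter of lookahead always tells the blocks apart.\<close>

lemma fib_subst_snoc_hd: "\<exists>y. fib_subst w @ [0] = 0 # y"
  by (cases w) auto

lemma set_fib_subst: "set (fib_subst w) \<subseteq> {0, 1}"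
  by (induction w) auto

text \<open>For each letter \<open>x\<close>, \<open>fib_subst [x] @ [0]\<close> is 010 or 00, a
  palindrome, so the padding 0 moves past one block at a time.\<close>

lemma rev_fib_subst: "rev (fib_subst w @ [0]) = fib_subst (rev w) @ [0]"
proof (induction w)
  case (Cons x w)
  then show ?case by auto
qed simp

lemma prefix_fib_subst:
  assumes "prefix u x"
  shows "prefix (fib_subst u @ [0]) (fib_subst x @ [0])"
proof -
  obtain z where "x = u @ z" using assms by (auto simp: prefix_def)
  then show ?thesis using fib_subst_snoc_hd[of z] by (auto simp: prefix_def)
qed

text \<open>Decoding is forced: 0 followed by 1 comes from the letter 0, and 0 followed by 0 from
  the letter 1.\<close>

lemma prefix_fib_substD:
  assumes "prefix (fib_subst u @ [0]) (fib_subst x @ [0])" "set u \<subseteq> {0, 1}" "set x \<subseteq> {0, 1}"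
  shows "prefix u x"
  using assms
proof (induction u arbitrary: x)
  case (Cons a u)
  obtain y where y: "fib_subst u @ [0] = 0 # y" using fib_subst_snoc_hd by blast
  show ?case
  proof (cases x)
    case Nil
    then show ?thesis using Cons.prems(1) by (auto split: if_splits)
  next
    case x: (Cons b x')
    obtain z where z: "fib_subst x' @ [0] = 0 # z" using fib_subst_snoc_hd by blast
    have "a = b \<and> prefix (fib_subst u @ [0]) (fib_subst x' @ [0])"
      using Cons.prems x y z by (auto split: if_splits)
    then show ?thesis using Cons.IH[of x'] Cons.prems x by auto
  qed
qed simp

text \<open>The padded image begins with 0, which only ever opens a block, so an occurrence starts
  at a block boundary.\<close>

lemma sublist_fib_substD:
  assumes "sublist (fib_subst u @ [0]) (fib_subst x @ [0])" "set u \<subseteq> {0, 1}" "set x \<subseteq> {0, 1}"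
  shows "sublist u x"
  using assms
proof (induction x)
  case Nil
  then show ?case by (cases u) (auto dest: sublist_length_le)
next
  case (Cons a x)
  obtain y where y: "fib_subst u @ [0] = 0 # y" using fib_subst_snoc_hd by blast
  consider "prefix (fib_subst u @ [0]) (fib_subst (a # x) @ [0])"
    | "sublist (fib_subst u @ [0]) (fib_subst x @ [0])"
    using Cons.prems(1) unfolding y by (auto simp: sublist_Cons_right split: if_splits)
  then show ?case
  proof cases
    case 1
    then show ?thesis using prefix_fib_substD Cons.prems by blast
  next
    case 2
    then show ?thesis using Cons by (auto simp: sublist_Cons_right)
  qed
qed

text \<open>The cut falls just before a 0, hence at a block boundary.\<close>

lemma prefix_of_fib_subst:
  assumes "prefix (w @ [0]) (fib_subst x @ [0])"
  shows "\<exists>v. prefix v x \<and> w = fib_subst v"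
  using assms
proof (induction x arbitrary: w)
  case Nil
  then show ?case by (auto simp: prefix_Cons)
next
  case (Cons a x)
  show ?case
  proof (cases "w = []")
    case False
    with Cons.prems obtain w' where w: "w = (if a = 0 then [0, 1] else [0]) @ w'"
      "prefix (w' @ [0]) (fib_subst x @ [0])"
      by (cases w; cases "tl w") (auto simp: prefix_Cons split: if_splits)
    then obtain v where "prefix v x" "w' = fib_subst v" using Cons.IH by blast
    then show ?thesis using w by (intro exI[of _ "a # v"]) auto
  qed (auto intro!: exI[of _ "[]"])
qed

text \<open>A 1 only closes a block 01, and what follows is another block or the final 0.\<close>

lemma fib_subst_neighbours_1:
  assumes "fib_subst x @ [0] = ys @ 1 # zs"
  shows "\<exists>ys' zs'. ys = ys' @ [0] \<and> zs = 0 # zs'"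
  using assms
proof (induction x arbitrary: ys)
  case Nil
  then show ?case by (cases ys) auto
next
  case (Cons a x)
  show ?case
  proof (cases "a = 0")
    case True
    obtain y where y: "fib_subst x @ [0] = 0 # y" using fib_subst_snoc_hd by blast
    from Cons.prems True obtain ys' where ys: "ys = 0 # ys'" by (cases ys) auto
    show ?thesis
    proof (cases ys')
      case Nil
      then show ?thesis using Cons.prems True ys y by auto
    next
      case (Cons b ys'')
      then have "fib_subst x @ [0] = ys'' @ 1 # zs" using Cons.prems True ys by auto
      from Cons.IH[OF this] show ?thesis using ys Cons by auto
    qed
  next
    case False
    with Cons.prems obtain ys' where ys: "ys = 0 # ys'" "fib_subst x @ [0] = ys' @ 1 # zs"
      by (cases ys) auto
    from Cons.IH[OF ys(2)] show ?thesis using ys by auto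
  qed
qed

section \<open>Central words\<close>

lemma fib_word_Suc: "1 \<le> n \<Longrightarrow> fib_word (Suc n) = fib_subst (fib_word n)"
proof (induction n rule: fib_word.induct)
  case (4 n)
  have "fib_word (Suc (Suc (Suc (Suc n)))) = fib_word (Suc (Suc (Suc n))) @ fib_word (Suc (Suc n))"
    by simp
  also have "\<dots> = fib_subst (fib_word (Suc (Suc n)) @ fib_word (Suc n))"
    using 4 by (simp only: fib_subst_simps)
  finally show ?case by simp
qed auto

lemma length_fib_word: "length (fib_word n) = fib n"
  by (induction n rule: fib_word.induct) auto

text \<open>The morphism sends 01 to 010 and 10 to 001: the last two letters swap at each step, and
  the 0 left over is the final 0 in \<open>fib_prefix_Suc\<close>.\<close>

lemma fib_word_eq:
  assumes "3 \<le> n"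
  shows "fib_word n = fib_prefix n @ (if odd n then [0, 1] else [1, 0])"
  using assms
proof (induction n rule: nat_induct_at_least)
  case base
  then show ?case by (simp add: fib_prefix_def numeral_3_eq_3)
next
  case (Suc n)
  then show ?case
    unfolding fib_prefix_def[of "Suc n"] by (auto simp: fib_word_Suc butlast_append)
qed

lemma fib_prefix_Suc: "3 \<le> n \<Longrightarrow> fib_prefix (Suc n) = fib_subst (fib_prefix n) @ [0]"
  unfolding fib_prefix_def[of "Suc n"]
  using fib_word_eq[of n] by (auto simp: fib_word_Suc butlast_append)

lemma fib_prefix_3: "fib_prefix 3 = []"
  by (simp add: fib_prefix_def eval_nat_numeral)

lemma length_fib_prefix: "3 \<le> n \<Longrightarrow> length (fib_prefix n) + 2 = fib n"
  using fib_word_eq[of n] length_fib_word[of n] by (auto split: if_splits)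

lemma set_fib_prefix: "3 \<le> n \<Longrightarrow> set (fib_prefix n) \<subseteq> {0, 1}"
proof (induction n rule: nat_induct_at_least)
  case (Suc n)
  then show ?case using set_fib_subst[of "fib_prefix n"] by (auto simp: fib_prefix_Suc)
qed (simp add: fib_prefix_3)

lemma rev_fib_prefix: "3 \<le> n \<Longrightarrow> rev (fib_prefix n) = fib_prefix n"
proof (induction n rule: nat_induct_at_least)
  case (Suc n)
  then show ?case using rev_fib_subst[of "fib_prefix n"] by (simp add: fib_prefix_Suc)
qed (simp add: fib_prefix_3)

text \<open>After \<open>fib_subst (fib_prefix n)\<close>, a next letter 0 yields 01 and a next
  letter 1 yields 00 with the padding. The first 0 completes \<open>fib_prefix (Suc n)\<close>, so
  the letter after it alternates.\<close>

lemma prefix_fib_prefix_Suc: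
  "3 \<le> n \<Longrightarrow> prefix (fib_prefix n @ [if odd n then 0 else 1]) (fib_prefix (Suc n))"
proof (induction n rule: nat_induct_at_least)
  case base
  then show ?case using fib_prefix_Suc[of 3] by (simp add: fib_prefix_3)
next
  case (Suc n)
  have "prefix (fib_subst (fib_prefix n @ [if odd n then 0 else 1]) @ [0]) (fib_prefix (Suc (Suc n)))"
    using prefix_fib_subst[OF Suc.IH] fib_prefix_Suc[of "Suc n"] Suc.hyps by simp
  then show ?case
    using Suc.hyps by (auto simp: fib_prefix_Suc prefix_def split: if_splits)
qed

lemma prefix_fib_prefix:
  assumes "3 \<le> n" "n \<le> m"
  shows "prefix (fib_prefix n) (fib_prefix m)"
  using assms(2)
proof (induction m rule: dec_induct)
  case (step m)
  then have "prefix (fib_prefix m) (fib_prefix (Suc m))"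
    using append_prefixD[OF prefix_fib_prefix_Suc[of m]] assms(1) by simp
  with step.IH show ?case by (rule prefix_order.trans)
qed simp

lemma prefix_fib_prefix_snoc:
  assumes "3 \<le> n" "n < m"
  shows "prefix (fib_prefix n @ [if odd n then 0 else 1]) (fib_prefix m)"
proof (rule prefix_order.trans)
  show "prefix (fib_prefix (Suc n)) (fib_prefix m)"
    using assms by (intro prefix_fib_prefix) auto
qed (rule prefix_fib_prefix_Suc[OF assms(1)])

text \<open>A nonempty palindromic prefix starts, hence ends, with 0. It is therefore a padded image
  \<open>fib_subst v @ [0]\<close>, and \<open>v\<close> is again a palindromic prefix, one level
  lower.\<close>

lemma palindromic_prefix_fib_prefix:
  assumes "3 \<le> n" "prefix w (fib_prefix n)" "rev w = w"
  shows "\<exists>k. 3 \<le> k \<and> k \<le> n \<and> w = fib_prefix k"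
  using assms
proof (induction n arbitrary: w rule: nat_induct_at_least)
  case base
  then show ?case by (auto simp: fib_prefix_3)
next
  case (Suc n)
  show ?case
  proof (cases "w = []")
    case True
    then show ?thesis using Suc.hyps by (intro exI[of _ 3]) (auto simp: fib_prefix_3)
  next
    case False
    have w: "prefix w (fib_subst (fib_prefix n) @ [0])"
      using Suc by (simp add: fib_prefix_Suc)
    obtain y where "fib_subst (fib_prefix n) @ [0] = 0 # y" using fib_subst_snoc_hd by blast
    with w False have "hd w = 0" by (metis hd_append2 list.sel(1) prefix_def)
    then have "last w = 0" using Suc.prems False by (metis hd_rev)
    then obtain w' where w': "w = w' @ [0]" using False by (metis append_butlast_last_id)
    then obtain v where v: "prefix v (fib_prefix n)" "w' = fib_subst v"
      using prefix_of_fib_subst w by blast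
    have set: "set v \<subseteq> {0, 1}"
      using set_fib_prefix[OF Suc.hyps] set_mono_prefix[OF v(1)] by blast
    have "fib_subst (rev v) @ [0] = fib_subst v @ [0]"
      using rev_fib_subst[of v] Suc.prems(2) by (simp add: w' v(2))
    then have "prefix (rev v) v"
      using set by (auto intro!: prefix_fib_substD[of "rev v" v])
    then obtain z where z: "v = rev v @ z" by (auto simp: prefix_def)
    then have "length v = length v + length z" by (metis length_append length_rev)
    then have "z = []" by simp
    with z have "rev v = v" by simp
    then obtain k where "3 \<le> k" "k \<le> n" "v = fib_prefix k" using Suc.IH v by blast
    then show ?thesis using v w' by (intro exI[of _ "Suc k"]) (auto simp: fib_prefix_Suc)
  qed
qed

section \<open>Minimal forbidden factors\<close>

lemma length_min_forbidden: "3 \<le> n \<Longrightarrow> length (min_forbidden n) = fib n"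
  using length_fib_prefix[of n] by (simp add: min_forbidden_def)

lemma set_min_forbidden: "3 \<le> n \<Longrightarrow> set (min_forbidden n) \<subseteq> {0, 1}"
  using set_fib_prefix[of n] by (auto simp: min_forbidden_def)

lemma fib_subst_min_forbidden:
  assumes "3 \<le> n"
  shows "fib_subst (min_forbidden n) @ [0] =
    (if odd n then min_forbidden (Suc n) else 0 # min_forbidden (Suc n) @ [0])"
  using assms by (simp add: min_forbidden_def fib_prefix_Suc)

lemma min_forbidden_sublist_SucD:
  assumes "3 \<le> a" "3 \<le> b" "sublist (min_forbidden (Suc a)) (min_forbidden (Suc b))"
  shows "sublist (min_forbidden a) (min_forbidden b)"
proof -
  let ?w = "fib_subst (min_forbidden b) @ [0]"
  have "sublist (min_forbidden (Suc b)) ?w"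
    using fib_subst_min_forbidden[OF assms(2)] by (auto simp: sublist_Cons_right split: if_splits)
  then have *: "sublist (min_forbidden (Suc a)) ?w"
    using assms(3) by (rule sublist_order.order.trans[rotated])
  have "sublist (fib_subst (min_forbidden a) @ [0]) ?w"
  proof (cases "odd a")
    case True
    then show ?thesis using * fib_subst_min_forbidden[OF assms(1)] by simp
  next
    case False
    then have M: "min_forbidden (Suc a) = 1 # fib_prefix (Suc a) @ [1]"
      by (simp add: min_forbidden_def)
    from * obtain ys zs where w: "?w = ys @ 1 # fib_prefix (Suc a) @ 1 # zs"
      unfolding M by (auto simp: sublist_def)
    \<comment> \<open>The word begins and ends with 1, so inside \<open>?w\<close> it is flanked by
      0 on both sides; this completes it to a padded image that can be decoded.\<close>
    obtain ys' where ys: "ys = ys' @ [0]" using fib_subst_neighbours_1[OF w] by auto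
    obtain zs' where zs: "zs = 0 # zs'"
      using fib_subst_neighbours_1[of _ "ys @ 1 # fib_prefix (Suc a)" zs] w by auto
    have "?w = ys' @ (0 # min_forbidden (Suc a) @ [0]) @ zs'"
      unfolding w ys zs M by simp
    then show ?thesis using fib_subst_min_forbidden[OF assms(1)] False
      by (auto simp: sublist_def)
  qed
  then show ?thesis using sublist_fib_substD set_min_forbidden assms by blast
qed

lemma min_forbidden_not_sublist:
  assumes "3 \<le> a" "a < b"
  shows "\<not> sublist (min_forbidden a) (min_forbidden b)"
  using assms
proof (induction a arbitrary: b rule: nat_induct_at_least)
  case base
  then obtain c where b: "b = Suc c" "3 \<le> c" by (cases b) auto
  show ?case
  proof
    assume "sublist (min_forbidden 3) (min_forbidden b)"
    \<comment> \<open>As \<open>b > 3\<close>, \<open>min_forbidden b\<close> lies inside a padded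
      image, where no two 1s are adjacent.\<close>
    moreover have "sublist (min_forbidden b) (fib_subst (min_forbidden c) @ [0])"
      using fib_subst_min_forbidden[OF b(2)] b(1)
      by (auto simp: sublist_Cons_right split: if_splits)
    ultimately have "sublist (min_forbidden 3) (fib_subst (min_forbidden c) @ [0])"
      by (rule sublist_order.order.trans)
    then have "sublist [1, 1] (fib_subst (min_forbidden c) @ [0])"
      by (simp add: min_forbidden_def fib_prefix_3)
    then obtain ys zs where "fib_subst (min_forbidden c) @ [0] = ys @ 1 # 1 # zs"
      by (auto simp: sublist_def)
    from fib_subst_neighbours_1[OF this] show False by auto
  qed
next
  case (Suc a)
  then obtain c where "b = Suc c" "a < c" by (cases b) auto
  then show ?case using Suc min_forbidden_sublist_SucD[of a c] by auto
qed

section \<open>Correlations\<close>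

text \<open>Lengths are recorded because an overlap of length \<open>l\<close> contributes the
  monomial of degree \<open>l - 1\<close>. Containment of one word in the other is treated
  separately.\<close>

definition overlaps :: "'a list \<Rightarrow> 'a list \<Rightarrow> nat set" where
  "overlaps u v = {length w | w. w \<noteq> [] \<and> strict_suffix w u \<and> strict_prefix w v}"

lemma finite_overlaps: "finite (overlaps u v)"
proof (rule finite_subset)
  show "overlaps u v \<subseteq> {..length u}"
    by (auto simp: overlaps_def strict_suffix_def dest: suffix_length_le)
qed simp

text \<open>The two truncations cover both cases: \<open>v\<close> may end inside \<open>u\<close>
  or run past its end.\<close>

lemma correlation_nth:
  assumes "k < length u"
  shows "correlation u v ! k = of_bool (take (length v) (drop k u) = take (length u - k) v)"
proof -
  have "(\<forall>i<length u. \<forall>j<length v. i = j + k \<longrightarrow> u ! i = v ! j) \<longleftrightarrow>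
      take (length v) (drop k u) = take (length u - k) v"
    by (auto simp: list_eq_iff_nth_eq add.commute less_diff_conv)
  then show ?thesis using assms by (simp add: correlation_def)
qed

lemma correlation_poly_eq_sum:
  "correlation_poly u v =
    (\<Sum>l | 0 < l \<and> l \<le> length u \<and> take (length v) (drop (length u - l) u) = take l v.
      monom 1 (l - 1))"
proof -
  have "correlation_poly u v =
      (\<Sum>k<length u. if take (length v) (drop k u) = take (length u - k) v
        then monom 1 (length u - 1 - k) else 0)"
    unfolding correlation_poly_def by (intro sum.cong) (auto simp: correlation_nth)
  also have "\<dots> = (\<Sum>k | k < length u \<and> take (length v) (drop k u) = take (length u - k) v.
      monom 1 (length u - 1 - k))"
    by (subst sum.inter_filter [symmetric]) (auto intro: sum.cong)
  also have "\<dots> =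
      (\<Sum>l | 0 < l \<and> l \<le> length u \<and> take (length v) (drop (length u - l) u) = take l v.
        monom 1 (l - 1))"
    by (rule sum.reindex_bij_witness[of _ "\<lambda>l. length u - l" "\<lambda>k. length u - k"]) auto
  finally show ?thesis .
qed

lemma mem_overlaps_iff:
  "l \<in> overlaps u v \<longleftrightarrow>
    0 < l \<and> l < length u \<and> l < length v \<and> drop (length u - l) u = take l v"
proof
  assume "l \<in> overlaps u v"
  then obtain w x y where "l = length w" "w \<noteq> []" "u = x @ w" "v = w @ y" "x \<noteq> []" "y \<noteq> []"
    by (auto simp: overlaps_def strict_suffix_def suffix_def strict_prefix_def prefix_def)
  then show "0 < l \<and> l < length u \<and> l < length v \<and> drop (length u - l) u = take l v"
    by auto
next
  assume *: "0 < l \<and> l < length u \<and> l < length v \<and> drop (length u - l) u = take l v"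
  have "strict_suffix (take l v) u"
    using * suffix_drop[of "length u - l" u] by (auto simp: strict_suffix_def)
  moreover have "strict_prefix (take l v) v"
    using * take_is_prefix[of l v] by (auto simp: strict_prefix_def)
  ultimately show "l \<in> overlaps u v"
    using * unfolding overlaps_def by (intro CollectI exI[of _ "take l v"]) auto
qed

text \<open>A matching \<open>l\<close> that is no proper overlap has
  \<open>l \<ge> length v\<close>, making \<open>v\<close> a factor of \<open>u\<close>, or
  \<open>l = length u\<close>, making \<open>u\<close> a prefix of \<open>v\<close>.\<close>

lemma correlation_poly_no_factor:
  assumes "\<not> sublist u v" "\<not> sublist v u"
  shows "correlation_poly u v = (\<Sum>l\<in>overlaps u v. monom 1 (l - 1))"
proof -
  have "0 < l \<and> l \<le> length u \<and> take (length v) (drop (length u - l) u) = take l v \<longleftrightarrow>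
      l \<in> overlaps u v" for l
  proof
    assume *: "0 < l \<and> l \<le> length u \<and> take (length v) (drop (length u - l) u) = take l v"
    have "l < length v"
    proof (rule ccontr)
      assume "\<not> l < length v"
      then have "take (length v) (drop (length u - l) u) = v" using * by simp
      moreover have "sublist (take (length v) (drop (length u - l) u)) u"
        by (rule sublist_order.order.trans[OF sublist_take sublist_drop])
      ultimately have "sublist v u" by (rule subst)
      with assms(2) show False by blast
    qed
    moreover have "l < length u"
    proof (rule ccontr)
      assume "\<not> l < length u"
      then have l: "l = length u" using * by linarith
      have "take l v = take (length v) (drop (length u - l) u)" using * by (metis (no_types))
      also have "\<dots> = u" using \<open>l < length v\<close> l by simp
      finally have "sublist u v" by (rule subst) (rule sublist_take)
      with assms(1) show False by blast
    qed
    ultimately show "l \<in> overlaps u v" using * by (simp add: mem_overlaps_iff)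
  qed (simp add: mem_overlaps_iff)
  then show ?thesis by (simp add: correlation_poly_eq_sum)
qed

text \<open>Shift 0 always matches and gives the leading term; any other matching shift gives a
  proper border of \<open>u\<close>.\<close>

lemma correlation_poly_self:
  assumes "u \<noteq> []"
  shows "correlation_poly u u = monom 1 (length u - 1) + (\<Sum>l\<in>overlaps u u. monom 1 (l - 1))"
proof -
  have "{l. 0 < l \<and> l \<le> length u \<and> take (length u) (drop (length u - l) u) = take l u} =
      insert (length u) (overlaps u u)"
    using assms by (auto simp: mem_overlaps_iff)
  moreover have "length u \<notin> overlaps u u" by (simp add: mem_overlaps_iff)
  ultimately show ?thesis by (simp add: correlation_poly_eq_sum finite_overlaps)
qed

section \<open>Overlaps of minimal forbidden factors\<close>

lemma fib_mono_less:
  assumes "2 \<le> a" "a < b"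
  shows "fib a < fib b"
proof -
  obtain c where "a = Suc c" "0 < c" using assms(1) by (cases a) auto
  then have "fib a < fib (Suc a)" using fib_neq_0_nat[of c] by simp
  also have "\<dots> \<le> fib b" using assms(2) by (intro fib_mono) simp
  finally show ?thesis .
qed

lemma prefix_fib_prefix_palindrome_snoc:
  assumes "3 \<le> a" "prefix (x @ [c]) (fib_prefix a)" "rev x = x"
  shows "\<exists>k. 3 \<le> k \<and> k < a \<and> x = fib_prefix k \<and> c = (if odd k then 0 else 1)"
proof -
  obtain k where k: "3 \<le> k" "k \<le> a" "x = fib_prefix k"
    using palindromic_prefix_fib_prefix assms by (blast dest: append_prefixD)
  have "k \<noteq> a" using prefix_length_le[OF assms(2)] k by auto
  with k have "k < a" by simp
  from prefix_same_cases[OF assms(2) prefix_fib_prefix_snoc[OF k(1) this]]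
  have "c = (if odd k then 0 else 1)" unfolding k(3) by (auto simp: prefix_def split: if_splits)
  with k \<open>k < a\<close> show ?thesis by blast
qed

lemma overlaps_min_forbidden:
  assumes "3 \<le> a" "3 \<le> b"
  shows "overlaps (min_forbidden a) (min_forbidden b) =
    (if even (a + b) then fib ` {k. 0 < k \<and> k < min a b \<and> odd (k + a)} else {})"
    (is "?L = ?R")
proof (intro equalityI subsetI)
  define ca cb :: nat where "ca = (if odd a then 1 else 0)" and "cb = (if odd b then 1 else 0)"
  have M: "min_forbidden a = [ca] @ fib_prefix a @ [ca]" "min_forbidden b = [cb] @ fib_prefix b @ [cb]"
    by (simp_all add: min_forbidden_def ca_def cb_def)
  fix l
  {
    assume "l \<in> ?L"
    then obtain w where w: "l = length w" "w \<noteq> []" "strict_suffix w ([ca] @ fib_prefix a @ [ca])"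
      "strict_prefix w ([cb] @ fib_prefix b @ [cb])"
      unfolding M overlaps_def by blast
    obtain x where x: "w = x @ [ca]" "suffix x (fib_prefix a)"
      using w(2,3)
      by (cases w rule: rev_cases) (auto simp: strict_suffix_def suffix_def Cons_eq_append_conv)
    obtain y where y: "w = cb # y" "prefix y (fib_prefix b)"
      using w(2,4) by (cases w) (auto simp: strict_prefix_def)
    show "l \<in> ?R"
    proof (cases x)
      case Nil
      then have "ca = cb" using x(1) y(1) by simp
      then have "even (a + b)" by (auto simp: ca_def cb_def split: if_splits)
      \<comment> \<open>Since \<open>fib 1 = fib 2 = 1\<close>, the index can be chosen with parity
        opposite to that of \<open>a\<close>.\<close>
      moreover have "l = fib (if odd a then 2 else 1)"
        using Nil x(1) w(1) by (simp add: numeral_2_eq_2)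
      ultimately show ?thesis using assms by auto
    next
      case (Cons c z)
      then have c: "c = cb" and yz: "y = z @ [ca]" using x(1) y(1) by simp_all
      \<comment> \<open>Reversal turns the suffix \<open>cb # z\<close> of the palindrome
        \<open>fib_prefix a\<close> into a prefix.\<close>
      have "prefix (rev z @ [cb]) (rev (fib_prefix a))"
        using x(2) Cons c by (simp add: suffix_to_prefix)
      then have pa: "prefix (rev z @ [cb]) (fib_prefix a)" using rev_fib_prefix assms by simp
      have pb: "prefix (z @ [ca]) (fib_prefix b)" using y yz by simp
      \<comment> \<open>Central words are nested, so both words are prefixes of the longer one;
        having equal length, they coincide.\<close>
      let ?N = "max a b"
      have "prefix (rev z @ [cb]) (fib_prefix ?N)" "prefix (z @ [ca]) (fib_prefix ?N)"
        using assms
        by (auto intro!: prefix_order.trans[OF pa] prefix_order.trans[OF pb]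
            prefix_fib_prefix)
      from prefix_same_cases[OF this] have z: "rev z = z" "ca = cb"
        by (auto simp: prefix_def)
      from z pa pb
      obtain k where k: "3 \<le> k" "k < a" "z = fib_prefix k" "ca = (if odd k then 0 else 1)"
        using prefix_fib_prefix_palindrome_snoc[OF assms(1)] by metis
      \<comment> \<open>The second index supplies the bound by \<open>b\<close>; comparing lengths
        identifies it with \<open>k\<close>.\<close>
      obtain k' where k': "3 \<le> k'" "k' < b" "z = fib_prefix k'"
        using prefix_fib_prefix_palindrome_snoc[OF assms(2) pb z(1)] by metis
      have "fib k = fib k'" using length_fib_prefix k k' by metis
      then have "k = k'" using fib_mono_less[of k k'] fib_mono_less[of k' k] k k' by linarith
      moreover have "l = fib k"
        using w(1) x(1) Cons k length_fib_prefix[of k] by simp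
      moreover have "odd (k + a)" "even (a + b)"
        using k(4) z(2) unfolding ca_def cb_def
        by (cases "odd a"; cases "odd b"; cases "odd k"; simp)+
      ultimately show ?thesis using k k' by auto
    qed
  }
  {
    assume "l \<in> ?R"
    then obtain k where ev: "even (a + b)" and k: "l = fib k" "0 < k" "k < a" "k < b" "odd (k + a)"
      by (auto split: if_splits)
    have cb: "cb = ca" using ev by (auto simp: ca_def cb_def)
    show "l \<in> ?L"
    proof (cases "3 \<le> k")
      case True
      have ca: "ca = (if odd k then 0 else 1)" using k by (auto simp: ca_def)
      have "prefix (fib_prefix k @ [ca]) (fib_prefix a)" "prefix (fib_prefix k @ [ca]) (fib_prefix b)"
        unfolding ca using prefix_fib_prefix_snoc True k by blast+
      then obtain x y where "fib_prefix a = fib_prefix k @ [ca] @ x" and y: "fib_prefix b = fib_prefix k @ [ca] @ y"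
        by (auto simp: prefix_def)
      \<comment> \<open>Reversing the decomposition makes \<open>[ca] @ fib_prefix k\<close> a
        suffix of \<open>fib_prefix a\<close>; the overlap is
        \<open>[ca] @ fib_prefix k @ [ca]\<close>, of length \<open>fib k\<close>.\<close>
      then have x: "fib_prefix a = rev x @ [ca] @ fib_prefix k"
        using rev_fib_prefix[OF assms(1)] rev_fib_prefix[OF True] by (metis append_assoc rev_append rev_singleton_conv)
      show ?thesis
        using x y length_fib_prefix[OF True] k unfolding M overlaps_def cb
        by (intro CollectI exI[of _ "[ca] @ fib_prefix k @ [ca]"])
          (auto simp: strict_suffix_def suffix_def strict_prefix_def prefix_def)
    next
      case False
      then have "k = 1 \<or> k = 2" using k by auto
      then have "l = 1" using k by (auto simp: eval_nat_numeral)
      then show ?thesis unfolding M overlaps_def cb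
        by (intro CollectI exI[of _ "[ca]"]) (auto simp: strict_suffix_def suffix_def strict_prefix_def)
    qed
  }
qed

section \<open>Evaluation of the sums over overlap lengths\<close>

lemma inj_on_fib:
  assumes "\<And>j k. j \<in> A \<Longrightarrow> k \<in> A \<Longrightarrow> 0 < j \<and> even (j + k)"
  shows "inj_on fib A"
proof (rule linorder_inj_onI')
  fix j k assume *: "j \<in> A" "k \<in> A" "j < k"
  show "fib j \<noteq> fib k"
  \<comment> \<open>The only repeated value at positive indices is \<open>fib 1 = fib 2\<close>, and
    equal parity excludes that pair.\<close>
  proof (cases "j = 1")
    case True
    then have "2 < k" using assms[OF *(1,2)] * by (cases "k = 2") auto
    then show ?thesis using True fib_mono_less[of 2 k] by simp
  next
    case False
    then show ?thesis using assms[OF *(1,2)] *(3) fib_mono_less[of j k] by simp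
  qed
qed

text \<open>Even indices go down to \<open>fib 2\<close>, at \<open>i = n - 1\<close>; the odd ones
  in \<open>sum_fib_odd\<close> go down to \<open>fib 1\<close>, which takes the further index
  \<open>i = n\<close>.\<close>

lemma sum_fib_even:
  "(\<Sum>l\<in>fib ` {k. 0 < k \<and> k < 2 * n + 1 \<and> even k}. g l) = (\<Sum>i=0..<n. g (fib (2 * (n - i))))"
proof -
  have "inj_on fib {k. 0 < k \<and> k < 2 * n + 1 \<and> even k}"
    by (rule inj_on_fib) auto
  then have "(\<Sum>l\<in>fib ` {k. 0 < k \<and> k < 2 * n + 1 \<and> even k}. g l) =
      (\<Sum>k | 0 < k \<and> k < 2 * n + 1 \<and> even k. g (fib k))"
    by (simp add: sum.reindex)
  also have "\<dots> = (\<Sum>i=0..<n. g (fib (2 * (n - i))))"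
    by (rule sum.reindex_bij_witness[of _ "\<lambda>i. 2 * (n - i)" "\<lambda>k. n - k div 2"]) auto
  finally show ?thesis .
qed

lemma sum_fib_odd:
  "(\<Sum>l\<in>fib ` {k. 0 < k \<and> k < 2 * n + 2 \<and> odd k}. g l) = (\<Sum>i=0..n. g (fib (2 * (n - i) + 1)))"
proof -
  have "inj_on fib {k. 0 < k \<and> k < 2 * n + 2 \<and> odd k}"
    by (rule inj_on_fib) auto
  then have "(\<Sum>l\<in>fib ` {k. 0 < k \<and> k < 2 * n + 2 \<and> odd k}. g l) =
      (\<Sum>k | 0 < k \<and> k < 2 * n + 2 \<and> odd k. g (fib k))"
    by (simp add: sum.reindex)
  also have "\<dots> = (\<Sum>i=0..n. g (fib (2 * (n - i) + 1)))"
    by (rule sum.reindex_bij_witness[of _ "\<lambda>i. 2 * (n - i) + 1" "\<lambda>k. n - k div 2"]) auto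
  finally show ?thesis .
qed

text \<open>Only \<open>min n m\<close> enters, which is the source of the symmetry of the
  correlations; \<open>n = m\<close> serves the autocorrelations.\<close>

lemma overlaps_min_forbidden_odd:
  assumes "1 \<le> n" "1 \<le> m"
  shows "overlaps (min_forbidden (2*n+1)) (min_forbidden (2*m+1)) =
    fib ` {k. 0 < k \<and> k < 2 * min n m + 1 \<and> even k}"
  using assms by (subst overlaps_min_forbidden) (auto simp: min_def intro!: image_cong)

lemma overlaps_min_forbidden_even:
  assumes "1 \<le> n" "1 \<le> m"
  shows "overlaps (min_forbidden (2*n+2)) (min_forbidden (2*m+2)) =
    fib ` {k. 0 < k \<and> k < 2 * min n m + 2 \<and> odd k}"
  using assms by (subst overlaps_min_forbidden) (auto simp: min_def intro!: image_cong)

lemma correlation_poly_min_forbidden_self: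
  assumes "3 \<le> a"
  shows "correlation_poly (min_forbidden a) (min_forbidden a) = monom 1 (fib a - 1) +
    (\<Sum>l\<in>overlaps (min_forbidden a) (min_forbidden a). monom 1 (l - 1))"
  using assms by (subst correlation_poly_self) (auto simp: length_min_forbidden fib_neq_0_nat simp flip: length_greater_0_conv)

lemma correlation_poly_min_forbidden_distinct:
  assumes "3 \<le> a" "3 \<le> b" "a \<noteq> b"
  shows "correlation_poly (min_forbidden a) (min_forbidden b) =
    (\<Sum>l\<in>overlaps (min_forbidden a) (min_forbidden b). monom 1 (l - 1))"
proof (rule correlation_poly_no_factor)
  \<comment> \<open>Stated for fresh \<open>a\<close> and \<open>b\<close> to cover both orders: a
    longer word is excluded by its length, a shorter one by
    \<open>min_forbidden_not_sublist\<close>.\<close>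
  have "\<not> sublist (min_forbidden a) (min_forbidden b)" if "3 \<le> a" "3 \<le> b" "a \<noteq> b" for a b
  proof (cases "a < b")
    case False
    then have "fib b < fib a" using fib_mono_less[of b a] that by simp
    then show ?thesis using that length_min_forbidden by (auto dest!: sublist_length_le)
  qed (use that min_forbidden_not_sublist in auto)
  then show "\<not> sublist (min_forbidden a) (min_forbidden b)"
    "\<not> sublist (min_forbidden b) (min_forbidden a)" using assms by auto
qed

theorem theorem5:
  fixes n m :: nat
  assumes "1 \<le> n" and "n < m"
  shows
   "correlation_poly (min_forbidden (2*n+1)) (min_forbidden (2*n+1)) =
       monom 1 (fib (2*n+1) - 1) + (\<Sum>i=0..<n. monom 1 (fib (2*(n-i)) - 1)) \<and>
    correlation_poly (min_forbidden (2*n+2)) (min_forbidden (2*n+2)) =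
       monom 1 (fib (2*n+2) - 1) + (\<Sum>i=0..n. monom 1 (fib (2*(n-i)+1) - 1)) \<and>
    correlation_poly (min_forbidden (2*n+1)) (min_forbidden (2*m+1)) =
       correlation_poly (min_forbidden (2*m+1)) (min_forbidden (2*n+1)) \<and>
    correlation_poly (min_forbidden (2*m+1)) (min_forbidden (2*n+1)) =
       (\<Sum>i=0..<n. monom 1 (fib (2*(n-i)) - 1)) \<and>
    correlation_poly (min_forbidden (2*n+2)) (min_forbidden (2*m+2)) =
       correlation_poly (min_forbidden (2*m+2)) (min_forbidden (2*n+2)) \<and>
    correlation_poly (min_forbidden (2*m+2)) (min_forbidden (2*n+2)) =
       (\<Sum>i=0..n. monom 1 (fib (2*(n-i)+1) - 1)) \<and>
    correlation_poly (min_forbidden (2*n+1)) (min_forbidden (2*m+2)) =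
       correlation_poly (min_forbidden (2*m+2)) (min_forbidden (2*n+1)) \<and>
    correlation_poly (min_forbidden (2*m+2)) (min_forbidden (2*n+1)) = 0 \<and>
    correlation_poly (min_forbidden (2*m+1)) (min_forbidden (2*n+2)) =
       correlation_poly (min_forbidden (2*n+2)) (min_forbidden (2*m+1)) \<and>
    correlation_poly (min_forbidden (2*n+2)) (min_forbidden (2*m+1)) = 0"
  proof -
  have ge: "3 \<le> 2*n+1" "3 \<le> 2*n+2" "3 \<le> 2*m+1" "3 \<le> 2*m+2" "1 \<le> m" using assms by auto
  have ne: "2*n+1 \<noteq> 2*m+1" "2*m+1 \<noteq> 2*n+1" "2*n+2 \<noteq> 2*m+2" "2*m+2 \<noteq> 2*n+2"
    "2*n+1 \<noteq> 2*m+2" "2*m+2 \<noteq> 2*n+1" "2*m+1 \<noteq> 2*n+2" "2*n+2 \<noteq> 2*m+1"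
    using assms by presburger+
  have mixed: "overlaps (min_forbidden (2*i+1)) (min_forbidden (2*j+2)) = {}"
    "overlaps (min_forbidden (2*j+2)) (min_forbidden (2*i+1)) = {}" if "1 \<le> i" "1 \<le> j" for i j
    using that by (subst overlaps_min_forbidden; simp)+
  have nm: "min n n = n" "min n m = n" "min m n = n" using assms by auto
  show ?thesis
    unfolding correlation_poly_min_forbidden_self[OF ge(1)] correlation_poly_min_forbidden_self[OF ge(2)]
      correlation_poly_min_forbidden_distinct[OF ge(1) ge(3) ne(1)]
      correlation_poly_min_forbidden_distinct[OF ge(3) ge(1) ne(2)]
      correlation_poly_min_forbidden_distinct[OF ge(2) ge(4) ne(3)]
      correlation_poly_min_forbidden_distinct[OF ge(4) ge(2) ne(4)]
      correlation_poly_min_forbidden_distinct[OF ge(1) ge(4) ne(5)]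
      correlation_poly_min_forbidden_distinct[OF ge(4) ge(1) ne(6)]
      correlation_poly_min_forbidden_distinct[OF ge(3) ge(2) ne(7)]
      correlation_poly_min_forbidden_distinct[OF ge(2) ge(3) ne(8)]
      overlaps_min_forbidden_odd[OF assms(1) assms(1)] overlaps_min_forbidden_odd[OF assms(1) ge(5)]
      overlaps_min_forbidden_odd[OF ge(5) assms(1)]
      overlaps_min_forbidden_even[OF assms(1) assms(1)] overlaps_min_forbidden_even[OF assms(1) ge(5)]
      overlaps_min_forbidden_even[OF ge(5) assms(1)]
      mixed[OF assms(1) ge(5)] mixed[OF ge(5) assms(1)] nm sum_fib_even sum_fib_odd
    by simp
qed

end
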